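(* Let $a,b:[0,\infty)\to\mathbb{R}$ be positive continuous functions, let $g:[0,\infty)\to\mathbb{R}$ be continuous and nonnegative, and let $x_0>0$. Suppose that $b$ is non-decreasing, and that $$\widehat{g}(t)<b(x_0)\int_t^\infty a(s)\,ds\qquad\text{for every } t\ge0.$$ If the solution $Y$ of $$Y_t=x_0+\int_0^t a(s)\,b(Y_s+g(s))\,ds,\quad t\ge0,$$ explodes in finite time, then $B(\infty)<A(\infty)$.
   Context: $\widehat{g}(t)=\sup\{g(s):s\in[0,t]\}$ for $t\ge0$. $A(\infty)=\int_0^\infty a(s)\,ds\in(0,\infty]$ and $B(\infty)=\int_{x_0}^\infty\frac{ds}{b(s)}\in(0,\infty]$. The solution $Y$ is a maximal continuous solution of the integral equation, assigned the value $\infty$ from the moment it becomes infinite; its time of explosion is $T_e=\sup\{t\ge0:Y_t<\infty\}$, and $Y$ explodes in finite time if $T_e<\infty$. *)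

theory Defs
  imports "HOL-Analysis.Analysis"
begin

definition running_sup :: "(real \<Rightarrow> real) \<Rightarrow> real \<Rightarrow> real" where
  "running_sup g t = (SUP s\<in>{0..t}. g s)"

(* The integrals over half-lines have positive integrands and may be infinite, so they are
   taken in the extended nonnegative reals. *)

definition tail_integral :: "(real \<Rightarrow> real) \<Rightarrow> real \<Rightarrow> ennreal" where
  "tail_integral a t = (\<integral>\<^sup>+ s\<in>{t..}. ennreal (a s) \<partial>lborel)"

definition A_inf :: "(real \<Rightarrow> real) \<Rightarrow> ennreal" where
  "A_inf a = tail_integral a 0"

definition B_inf :: "(real \<Rightarrow> real) \<Rightarrow> real \<Rightarrow> ennreal" where
  "B_inf b x0 = tail_integral (\<lambda>s. 1 / b s) x0"

(* A finite solution on a time interval I with left endpoint 0 (possibly unbounded, and with or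
   without its right endpoint).  The function b lives on [0, infinity), so y s + g s has to lie
   in its domain; values of b at negative arguments are meaningless. *)

definition solution_on ::
  "(real \<Rightarrow> real) \<Rightarrow> (real \<Rightarrow> real) \<Rightarrow> (real \<Rightarrow> real) \<Rightarrow> real \<Rightarrow> real set \<Rightarrow> (real \<Rightarrow> real) \<Rightarrow> bool" where
  "solution_on a b g x0 I y \<longleftrightarrow>
     is_interval I \<and> I \<subseteq> {0..} \<and> 0 \<in> I \<and> continuous_on I y \<and>
     (\<forall>t\<in>I. 0 \<le> y t + g t) \<and>
     (\<forall>t\<in>I. y t = x0 + integral {0..t} (\<lambda>s. a s * b (y s + g s)))"

(* Y is a solution that cannot be continued as a finite solution to a larger time interval, and
   it has the value infinity from then on.  Blow-up of y at the end of a bounded I is not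
   part of the definition. *)

definition maximal_solution ::
  "(real \<Rightarrow> real) \<Rightarrow> (real \<Rightarrow> real) \<Rightarrow> (real \<Rightarrow> real) \<Rightarrow> real \<Rightarrow> (real \<Rightarrow> ereal) \<Rightarrow> bool" where
  "maximal_solution a b g x0 Y \<longleftrightarrow>
     (\<exists>I y. solution_on a b g x0 I y \<and>
        (\<forall>J z. solution_on a b g x0 J z \<and> I \<subseteq> J \<and> (\<forall>t\<in>I. z t = y t) \<longrightarrow> J = I) \<and>
        (\<forall>t\<ge>0. Y t = (if t \<in> I then ereal (y t) else \<infinity>)))"

definition explosion_time :: "(real \<Rightarrow> ereal) \<Rightarrow> ereal" where
  "explosion_time Y = Sup {ereal t | t. 0 \<le> t \<and> Y t < \<infinity>}"

definition explodes_in_finite_time :: "(real \<Rightarrow> ereal) \<Rightarrow> bool" where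
  "explodes_in_finite_time Y \<longleftrightarrow> explosion_time Y < \<infinity>"

end

theory Submission
  imports Defs
begin

text \<open>
  Since \<open>b\<close> is monotone, Picard iteration started at a constant increases to a local solution, so a
  maximal solution with bounded lifetime lives on a half-open interval \<open>[0, T)\<close> and is unbounded there.
  With \<open>G = running_sup g T\<close> we have \<open>y' \<le> a b(y + G)\<close>; dividing by \<open>b(y + G)\<close> and integrating up to
  the explosion gives that the integral of \<open>1/b\<close> over \<open>[x0 + G, \<infinity>)\<close> is at most that of \<open>a\<close> over \<open>[0, T]\<close>.
  The missing piece of \<open>B_inf\<close> over \<open>[x0, x0 + G]\<close> is at most \<open>G / b(x0)\<close>, which the hypothesis
  on \<open>g\<close> at time \<open>T\<close> makes smaller than the integral of \<open>a\<close> over \<open>[T, \<infinity>)\<close>.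
\<close>

section \<open>Integrals over half-lines\<close>

lemma tail_integral_cong:
  assumes "\<And>x. x \<ge> c \<Longrightarrow> f x = h x"
  shows "tail_integral f c = tail_integral h c"
  unfolding tail_integral_def using assms by (intro nn_integral_cong) (auto simp: indicator_def)

text \<open>Nothing is known about \<open>f\<close> to the left of \<open>c\<close>. Freezing it
  there at \<open>f c\<close> makes it continuous, hence Borel measurable, on the whole line, and
  leaves every integral over a subset of \<open>{c..}\<close> unchanged.\<close>

lemma continuous_on_clamp:
  fixes f :: "real \<Rightarrow> real"
  assumes "continuous_on {c..} f"
  shows "continuous_on UNIV (\<lambda>x. f (max c x))"
  by (rule continuous_on_compose2[OF assms]) (auto intro!: continuous_intros)

lemma tail_integral_split:
  assumes cont: "continuous_on {c..} f" and nonneg: "\<And>x. x \<ge> c \<Longrightarrow> f x \<ge> 0" and "c \<le> d"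
  shows "tail_integral f c = ennreal (integral {c..d} f) + tail_integral f d"
proof -
  define h where "h = (\<lambda>x. f (max c x))"
  have h_cont: "continuous_on UNIV h"
    unfolding h_def by (rule continuous_on_clamp[OF cont])
  then have [measurable]: "h \<in> borel_measurable borel"
    by (simp add: borel_measurable_continuous_onI)
  have h_eq: "h x = f x" if "x \<ge> c" for x
    using that by (simp add: h_def)
  have "tail_integral f c = tail_integral h c"
    by (rule tail_integral_cong) (simp add: h_eq)
  \<comment> \<open>The left piece is half-open to keep the two indicators disjoint; its endpoint
    \<open>d\<close> is restored afterwards as a null set.\<close>
  also have "\<dots> = (\<integral>\<^sup>+x. ennreal (h x) * indicator {c..<d} x + ennreal (h x) * indicator {d..} x \<partial>lborel)"
    unfolding tail_integral_def using \<open>c \<le> d\<close>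
    by (intro nn_integral_cong) (auto simp: indicator_def)
  also have "\<dots> = (\<integral>\<^sup>+x. ennreal (h x) * indicator {c..<d} x \<partial>lborel) + tail_integral h d"
    unfolding tail_integral_def by (rule nn_integral_add) auto
  also have "(\<integral>\<^sup>+x. ennreal (h x) * indicator {c..<d} x \<partial>lborel)
      = (\<integral>\<^sup>+x. ennreal (h x) * indicator {c..d} x \<partial>lborel)"
    using AE_lborel_singleton[of d]
    by (intro nn_integral_cong_AE, eventually_elim) (auto simp: indicator_def)
  also have "\<dots> = ennreal (integral {c..d} h)"
  proof (rule nn_integral_has_integral_lebesgue')
    show "(h has_integral integral {c..d} h) {c..d}"
      using h_cont by (intro integrable_integral integrable_continuous_real) (rule continuous_on_subset, auto)
  next
    fix x
    show "x \<in> {c..d} \<Longrightarrow> 0 \<le> h x" using nonneg by (simp add: h_def)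
  qed
  also have "integral {c..d} h = integral {c..d} f"
    by (rule integral_cong) (simp add: h_eq)
  also have "tail_integral h d = tail_integral f d"
    using \<open>c \<le> d\<close> by (intro tail_integral_cong) (simp add: h_eq)
  finally show ?thesis .
qed

text \<open>Monotone convergence along the windows \<open>{c..c + real n}\<close>. It turns
  estimates up to each finite level of a solution into one over the whole half-line.\<close>

lemma tail_integral_le:
  assumes cont: "continuous_on {c..} f" and nonneg: "\<And>x. x \<ge> c \<Longrightarrow> f x \<ge> 0"
    and bound: "\<And>x. x \<ge> c \<Longrightarrow> integral {c..x} f \<le> K"
  shows "tail_integral f c \<le> ennreal K"
proof -
  define h where "h = (\<lambda>x. f (max c x))"
  have h_cont: "continuous_on UNIV h"
    unfolding h_def by (rule continuous_on_clamp[OF cont])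
  then have [measurable]: "h \<in> borel_measurable borel"
    by (simp add: borel_measurable_continuous_onI)
  have h_nonneg: "h x \<ge> 0" for x
    using nonneg by (simp add: h_def)
  have h_eq: "h x = f x" if "x \<ge> c" for x
    using that by (simp add: h_def)
  have "tail_integral f c = tail_integral h c"
    by (rule tail_integral_cong) (simp add: h_eq)
  also have "\<dots> = (\<integral>\<^sup>+x. (SUP n. ennreal (h x) * indicator {c..c + real n} x) \<partial>lborel)"
    unfolding tail_integral_def
  proof (rule nn_integral_cong)
    fix x
    obtain n where "x - c \<le> real n" using real_arch_simple by blast
    then have "ennreal (h x) * indicator {c..} x \<le> ennreal (h x) * indicator {c..c + real n} x"
      by (auto simp: indicator_def)
    also have "\<dots> \<le> (SUP n. ennreal (h x) * indicator {c..c + real n} x)"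
      by (rule SUP_upper) simp
    finally have "ennreal (h x) * indicator {c..} x \<le> \<dots>" .
    moreover have "(SUP n. ennreal (h x) * indicator {c..c + real n} x) \<le> ennreal (h x) * indicator {c..} x"
      by (rule SUP_least) (auto simp: indicator_def)
    ultimately show "ennreal (h x) * indicator {c..} x
        = (SUP n. ennreal (h x) * indicator {c..c + real n} x)"
      by (rule antisym)
  qed
  also have "\<dots> = (SUP n. \<integral>\<^sup>+x. ennreal (h x) * indicator {c..c + real n} x \<partial>lborel)"
    by (rule nn_integral_monotone_convergence_SUP) (auto simp: incseq_def le_fun_def indicator_def)
  also have "\<dots> \<le> ennreal K"
  proof (rule SUP_least)
    fix n :: nat
    have "(\<integral>\<^sup>+x. ennreal (h x) * indicator {c..c + real n} x \<partial>lborel)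
        = ennreal (integral {c..c + real n} h)"
      using h_cont h_nonneg
      by (intro nn_integral_has_integral_lebesgue' integrable_integral integrable_continuous_real)
        (auto intro: continuous_on_subset)
    also have "integral {c..c + real n} h = integral {c..c + real n} f"
      by (rule integral_cong) (simp add: h_eq)
    also have "ennreal \<dots> \<le> ennreal K"
      by (intro ennreal_leI bound) simp
    finally show "(\<integral>\<^sup>+x. ennreal (h x) * indicator {c..c + real n} x \<partial>lborel) \<le> ennreal K" .
  qed
  finally show ?thesis .
qed

text \<open>Maximality treats the two shapes of a lifetime differently. The closed shape includes
  the degenerate \<open>I = {0}\<close>, so continuation must work from \<open>T = 0\<close> as
  well.\<close>

lemma interval_from_zero_cases:
  fixes I :: "real set"
  assumes "is_interval I" "I \<subseteq> {0..}" "0 \<in> I" "bdd_above I"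
  obtains T where "0 \<le> T" "I = {0..T}" | T where "0 < T" "I = {0..<T}"
proof -
  define T where "T = Sup I"
  have le: "t \<le> T" if "t \<in> I" for t
    using that assms(4) unfolding T_def by (rule cSup_upper)
  have mem: "t \<in> I" if t: "0 \<le> t" "t < T" for t
  proof -
    obtain s where "s \<in> I" "t < s"
      using less_cSupE[of t I] t(2) assms(3) unfolding T_def by blast
    then show ?thesis
      using mem_is_interval_1_I[OF assms(1,3), of s t] t by simp
  qed
  show thesis
  proof (cases "T \<in> I")
    case True
    have "t \<in> I \<longleftrightarrow> t \<in> {0..T}" for t
      using le[of t] mem[of t] subsetD[OF assms(2), of t] True
      by (metis atLeast_iff atLeastAtMost_iff order_le_less)
    then have "I = {0..T}" by (rule set_eqI)
    then show thesis using that(1)[of T] le[OF assms(3)] by blast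
  next
    case False
    have "t \<in> I \<longleftrightarrow> t \<in> {0..<T}" for t
      using le[of t] mem[of t] subsetD[OF assms(2), of t] False
      by (metis atLeast_iff atLeastLessThan_iff order_le_less)
    then have "I = {0..<T}" by (rule set_eqI)
    moreover have "0 < T"
      using le[OF assms(3)] False assms(3) by (metis order_le_less)
    ultimately show thesis using that(2)[of T] by blast
  qed
qed

section \<open>Local existence for a non-decreasing rate\<close>

locale increasing_rate =
  fixes a b g :: "real \<Rightarrow> real"
  assumes a_cont: "continuous_on {0..} a" and a_pos: "\<And>t. t \<ge> 0 \<Longrightarrow> a t > 0"
    and b_cont: "continuous_on {0..} b" and b_pos: "\<And>x. x \<ge> 0 \<Longrightarrow> b x > 0"
    and g_cont: "continuous_on {0..} g" and g_nonneg: "\<And>t. t \<ge> 0 \<Longrightarrow> g t \<ge> 0"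
    and b_mono: "mono_on {0..} b"
begin

lemma b_le: "0 \<le> x \<Longrightarrow> x \<le> x' \<Longrightarrow> b x \<le> b x'"
  using b_mono by (auto intro: mono_onD)

lemma inverse_b_continuous:
  assumes "S \<subseteq> {0..}"
  shows "continuous_on S (\<lambda>s. 1 / b s)"
  using continuous_on_subset[OF b_cont assms] b_pos assms
  by (intro continuous_intros) (auto simp: less_imp_neq[symmetric])

lemma rate_continuous:
  assumes "continuous_on J y" "J \<subseteq> {0..}" "\<And>t. t \<in> J \<Longrightarrow> 0 \<le> y t + g t"
  shows "continuous_on J (\<lambda>s. a s * b (y s + g s))"
proof (intro continuous_on_mult continuous_on_compose2[OF b_cont] continuous_on_add assms(1))
  show "continuous_on J a" "continuous_on J g"
    using a_cont g_cont assms(2) by (auto intro: continuous_on_subset)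
qed (use assms(3) in auto)

lemma rate_nonneg: "0 \<le> s \<Longrightarrow> 0 \<le> y s + g s \<Longrightarrow> 0 \<le> a s * b (y s + g s)"
  by (simp add: a_pos b_pos less_imp_le)

text \<open>Without a Lipschitz condition on \<open>b\<close> the Picard map need not contract. It
  is monotone, however, so its iterates from the constant \<open>c\<close> increase; they stay below
  \<open>c + 1\<close>, hence converge pointwise, and dominated convergence passes to the limit in
  the integral equation.\<close>

lemma local_solution:
  assumes "0 \<le> T" "0 \<le> c"
  obtains d z where "0 < d" "continuous_on {T..T + d} z" "\<And>t. t \<in> {T..T + d} \<Longrightarrow> c \<le> z t"
    "\<And>t. t \<in> {T..T + d} \<Longrightarrow> z t = c + integral {T..t} (\<lambda>s. a s * b (z s + g s))"
proof -
  define R where "R y = (\<lambda>s. a s * b (y s + g s))" for y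
  have "continuous_on {T..T + 1} (R (\<lambda>_. c + 1))"
    unfolding R_def using assms g_nonneg by (intro rate_continuous) auto
  then have "bounded (R (\<lambda>_. c + 1) ` {T..T + 1})"
    by (intro compact_imp_bounded compact_continuous_image) auto
  then obtain M where "M > 0" and M: "\<And>s. s \<in> {T..T + 1} \<Longrightarrow> R (\<lambda>_. c + 1) s \<le> M"
    by (force simp: bounded_pos)
  \<comment> \<open>\<open>M\<close> bounds the rate frozen at level \<open>c + 1\<close> on
    \<open>{T..T + 1}\<close>. The bound 1 keeps times in that window, and \<open>1 / M\<close> lets
    an iterate rise by at most 1.\<close>
  define d where "d = min 1 (1 / M)"
  define J where "J = {T..T + d}"
  have d: "0 < d" "d \<le> 1" "d * M \<le> 1"
    using \<open>M > 0\<close> by (auto simp: d_def min_def field_simps)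
  have J0: "0 \<le> s" if "s \<in> J" for s using that assms by (simp add: J_def)
  define u where "u n = ((\<lambda>y t. c + integral {T..t} (R y)) ^^ n) (\<lambda>_. c)" for n
  have u_0: "u 0 t = c" and u_Suc: "u (Suc n) t = c + integral {T..t} (R (u n))" for n t
    by (simp_all add: u_def)
  have R_le: "R y s \<le> R y' s" if "s \<in> J" "c \<le> y s" "y s \<le> y' s" for y y' s
    unfolding R_def using that J0 g_nonneg[of s] a_pos[of s] assms by (intro mult_left_mono b_le) auto
  have R_M: "0 \<le> R y s \<and> R y s \<le> M" if "s \<in> J" "c \<le> y s" "y s \<le> c + 1" for y s
  proof
    show "0 \<le> R y s"
      unfolding R_def using that J0 g_nonneg[of s] assms by (intro rate_nonneg) auto
    have "R y s \<le> R (\<lambda>_. c + 1) s" using that by (intro R_le) auto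
    also have "\<dots> \<le> M" using that d by (intro M) (auto simp: J_def)
    finally show "R y s \<le> M" .
  qed
  have R_cont: "continuous_on J (R y)" if "continuous_on J y" "\<And>s. s \<in> J \<Longrightarrow> c \<le> y s" for y
    unfolding R_def using that(1)
  proof (rule rate_continuous)
    fix t assume "t \<in> J"
    then show "0 \<le> y t + g t" using that(2)[of t] g_nonneg[of t] J0[of t] assms by simp
  qed (use J0 in auto)
  have R_int: "R y integrable_on {T..t}" if "continuous_on J (R y)" "t \<in> J" for y t
    using that by (intro integrable_continuous_real) (auto simp: J_def intro: continuous_on_subset)
  have u_prop: "continuous_on J (u n) \<and> (\<forall>t\<in>J. c \<le> u n t \<and> u n t \<le> c + 1)" for n
  proof (induction n)
    case 0
    show ?case by (simp add: u_0 cong: continuous_on_cong)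
  next
    case (Suc n)
    have cont: "continuous_on J (R (u n))" using Suc by (intro R_cont) auto
    have "continuous_on J (u (Suc n))"
      unfolding u_Suc J_def using R_int[OF cont, of "T + d"] d
      by (intro continuous_intros indefinite_integral_continuous_1) (auto simp: J_def)
    moreover have "c \<le> u (Suc n) t \<and> u (Suc n) t \<le> c + 1" if t: "t \<in> J" for t
    proof -
      have sub: "s \<in> J" if "s \<in> {T..t}" for s using that t by (auto simp: J_def)
      have "0 \<le> integral {T..t} (R (u n))"
        using R_int[OF cont t] R_M Suc sub by (intro integral_nonneg) auto
      moreover have "integral {T..t} (R (u n)) \<le> integral {T..t} (\<lambda>_. M)"
        using R_int[OF cont t] R_M Suc sub by (intro integral_le) auto
      moreover have "integral {T..t} (\<lambda>_. M) \<le> d * M"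
        using t \<open>M > 0\<close> by (simp add: J_def)
      ultimately show ?thesis using d by (simp add: u_Suc)
    qed
    ultimately show ?case by blast
  qed
  \<comment> \<open>The base case is the lower bound \<open>c\<close> for the first iterate;
    monotonicity of \<open>b\<close> then carries the order through the integral.\<close>
  have u_mono: "\<forall>t\<in>J. u n t \<le> u (Suc n) t" for n
  proof (induction n)
    case 0
    then show ?case using u_prop[of "Suc 0"] by (simp add: u_0)
  next
    case (Suc n)
    show ?case
    proof
      fix t assume t: "t \<in> J"
      have sub: "s \<in> J" if "s \<in> {T..t}" for s using that t by (auto simp: J_def)
      have "integral {T..t} (R (u n)) \<le> integral {T..t} (R (u (Suc n)))"
        using u_prop Suc sub t by (intro integral_le R_int R_cont R_le) auto
      then show "u (Suc n) t \<le> u (Suc (Suc n)) t" by (simp add: u_Suc[of n] u_Suc[of "Suc n"])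
    qed
  qed
  have "\<exists>l. (\<lambda>n. u n t) \<longlonglongrightarrow> l" if "t \<in> J" for t
  proof -
    have "incseq (\<lambda>n. u n t)" using u_mono that by (intro incseq_SucI) auto
    then show ?thesis using u_prop that by (meson incseq_convergent)
  qed
  then obtain z where z: "\<And>t. t \<in> J \<Longrightarrow> (\<lambda>n. u n t) \<longlonglongrightarrow> z t" by metis
  have z_ge: "c \<le> z t" if "t \<in> J" for t
    using z[OF that] u_prop that by (intro LIMSEQ_le_const) auto
  have R_lim: "(\<lambda>n. R (u n) s) \<longlonglongrightarrow> R z s" if s: "s \<in> J" for s
  proof -
    have pos: "0 \<le> w + g s" if "c \<le> w" for w using that g_nonneg[of s] J0[OF s] assms by simp
    have "(\<lambda>n. b (u n s + g s)) \<longlonglongrightarrow> b (z s + g s)"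
      using u_prop s z_ge pos
      by (intro continuous_on_tendsto_compose[OF b_cont] tendsto_intros z) auto
    then show ?thesis unfolding R_def by (intro tendsto_intros)
  qed
  have lim: "R z integrable_on {T..t} \<and> z t = c + integral {T..t} (R z)" if t: "t \<in> J" for t
  proof -
    have sub: "s \<in> J" if "s \<in> {T..t}" for s using that t by (auto simp: J_def)
    have "R (u n) integrable_on {T..t}" for n
      using u_prop t by (intro R_int R_cont) auto
    moreover have "norm (R (u n) s) \<le> M" if "s \<in> {T..t}" for n s
      using R_M[of s "u n"] sub[OF that] u_prop by auto
    moreover have "(\<lambda>n. R (u n) s) \<longlonglongrightarrow> R z s" if "s \<in> {T..t}" for s
      using R_lim sub[OF that] .
    ultimately have *: "R z integrable_on {T..t}"
      "(\<lambda>n. integral {T..t} (R (u n))) \<longlonglongrightarrow> integral {T..t} (R z)"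
      using dominated_convergence[of "\<lambda>n. R (u n)" "{T..t}" "\<lambda>_. M" "R z"] by blast+
    have "(\<lambda>n. u (Suc n) t) \<longlonglongrightarrow> c + integral {T..t} (R z)"
      unfolding u_Suc by (intro tendsto_intros *)
    then show ?thesis using * LIMSEQ_Suc[OF z[OF t]] LIMSEQ_unique by blast
  qed
  \<comment> \<open>A pointwise limit need not be continuous; continuity of \<open>z\<close> is read
    off from the equation it satisfies, as an indefinite integral.\<close>
  have "continuous_on J (\<lambda>t. c + integral {T..t} (R z))"
    unfolding J_def using lim[of "T + d"] d
    by (intro continuous_intros indefinite_integral_continuous_1) (auto simp: J_def)
  then have "continuous_on J z" using lim by (simp cong: continuous_on_cong)
  then show thesis
    using that[of d z] d z_ge lim unfolding J_def R_def by blast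
qed

section \<open>Lower bound and continuation of solutions\<close>

text \<open>The condition \<open>0 \<le> y t + g t\<close> already makes the rate nonnegative. The
  resulting bound keeps solutions in the range where \<open>b\<close> is positive and
  monotone.\<close>

lemma solution_ge:
  assumes "solution_on a b g x0 I y" "t \<in> I"
  shows "x0 \<le> y t"
proof -
  have I: "is_interval I" "I \<subseteq> {0..}" "0 \<in> I" and y: "continuous_on I y" "\<And>t. t \<in> I \<Longrightarrow> 0 \<le> y t + g t"
    and eq: "y t = x0 + integral {0..t} (\<lambda>s. a s * b (y s + g s))"
    using assms unfolding solution_on_def by auto
  have sub: "{0..t} \<subseteq> I"
    using mem_is_interval_1_I[OF I(1,3) assms(2)] by auto
  have "continuous_on {0..t} (\<lambda>s. a s * b (y s + g s))"
    using rate_continuous[OF y(1) I(2)] y(2) sub by (auto intro: continuous_on_subset)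
  then have "0 \<le> integral {0..t} (\<lambda>s. a s * b (y s + g s))"
    using sub y(2) by (intro integral_nonneg integrable_continuous_real rate_nonneg) auto
  then show ?thesis using eq by simp
qed

text \<open>A local solution restarted at time \<open>T\<close> from the value \<open>y T\<close> is
  glued on, and the integral splits at \<open>T\<close>. Hence a closed bounded lifetime is never
  maximal.\<close>

lemma solution_extends_beyond:
  assumes sol: "solution_on a b g x0 {0..T} y" and "0 < x0" "0 \<le> T"
  obtains d z where "0 < d" "solution_on a b g x0 {0..T + d} z" "\<And>t. t \<in> {0..T} \<Longrightarrow> z t = y t"
proof -
  have "0 \<le> y T" using solution_ge[OF sol, of T] assms by auto
  then obtain d v where d: "0 < d" and v: "continuous_on {T..T + d} v"
    and v_ge: "\<And>t. t \<in> {T..T + d} \<Longrightarrow> y T \<le> v t"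
    and v_eq: "\<And>t. t \<in> {T..T + d} \<Longrightarrow> v t = y T + integral {T..t} (\<lambda>s. a s * b (v s + g s))"
    by (rule local_solution[OF assms(3)]) (rule that)
  define z where "z t = (if t \<le> T then y t else v t)" for t
  define R where "R w = (\<lambda>s. a s * b (w s + g s))" for w
  have vT: "v T = y T" using v_eq[of T] d by simp
  have y_cont: "continuous_on {0..T} y" and y_nonneg: "\<And>t. t \<in> {0..T} \<Longrightarrow> 0 \<le> y t + g t"
    and y_eq: "\<And>t. t \<in> {0..T} \<Longrightarrow> y t = x0 + integral {0..t} (R y)"
    using sol unfolding solution_on_def R_def by auto
  have z_y: "z t = y t" if "t \<le> T" for t using that by (simp add: z_def)
  \<comment> \<open>The branches agree at \<open>T\<close>, so \<open>z\<close> equals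
    \<open>v\<close> on all of the closed interval, as gluing along two closed sets
    requires.\<close>
  have z_v: "z t = v t" if "T \<le> t" for t using that vT by (auto simp: z_def)
  have "continuous_on ({0..T} \<union> {T..T + d}) z"
  proof (intro continuous_on_closed_Un)
    show "continuous_on {0..T} z"
      using y_cont z_y by (subst continuous_on_cong[OF refl, of _ z y]) auto
    show "continuous_on {T..T + d} z"
      using v z_v by (subst continuous_on_cong[OF refl, of _ z v]) auto
  qed auto
  moreover have un: "{0..T} \<union> {T..T + d} = {0..T + d}" using d assms by auto
  ultimately have z_cont: "continuous_on {0..T + d} z" by simp
  have z_nonneg: "0 \<le> z t + g t" if "t \<in> {0..T + d}" for t
  proof (cases "t \<le> T")
    case True
    then show ?thesis using y_nonneg[of t] that by (simp add: z_y)
  next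
    case False
    then show ?thesis using v_ge[of t] that \<open>0 \<le> y T\<close> g_nonneg[of t] by (simp add: z_v)
  qed
  have R_cont: "continuous_on {0..T + d} (R z)"
    unfolding R_def using z_cont z_nonneg by (intro rate_continuous) auto
  have "z t = x0 + integral {0..t} (R z)" if t: "t \<in> {0..T + d}" for t
  proof (cases "t \<le> T")
    case True
    have "integral {0..t} (R z) = integral {0..t} (R y)"
      using True by (intro integral_cong) (simp add: R_def z_y)
    then show ?thesis using y_eq[of t] True t by (simp add: z_y)
  next
    case False
    have "integral {0..t} (R z) = integral {0..T} (R z) + integral {T..t} (R z)"
      using False t assms R_cont
      by (intro Henstock_Kurzweil_Integration.integral_combine[symmetric] integrable_continuous_real)
        (auto intro: continuous_on_subset)
    also have "integral {0..T} (R z) = integral {0..T} (R y)"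
      by (intro integral_cong) (simp add: R_def z_y)
    also have "integral {T..t} (R z) = integral {T..t} (R v)"
      by (intro integral_cong) (simp add: R_def z_v)
    finally show ?thesis
      using y_eq[of T] v_eq[of t] False t assms by (simp add: z_v R_def)
  qed
  then have "solution_on a b g x0 {0..T + d} z"
    unfolding solution_on_def using z_cont z_nonneg d assms(3)
    by (auto simp: R_def is_interval_cc)
  then show thesis using that[of d z] d z_y by auto
qed

text \<open>By monotonicity of \<open>b\<close>, an upper bound \<open>K\<close> for
  \<open>y\<close> bounds the rate by its values at the constant \<open>K\<close>. So
  \<open>y\<close> is Lipschitz and has a continuous extension to \<open>T\<close>.\<close>

lemma bounded_solution_extends_to_endpoint:
  assumes sol: "solution_on a b g x0 {0..<T} y" and "0 < x0" "0 < T"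
    and bound: "\<And>t. t \<in> {0..<T} \<Longrightarrow> y t \<le> K"
  obtains z where "solution_on a b g x0 {0..T} z" "\<And>t. t \<in> {0..<T} \<Longrightarrow> z t = y t"
proof -
  define R where "R w = (\<lambda>s. a s * b (w s + g s))" for w
  have y_cont: "continuous_on {0..<T} y" and y_nonneg: "\<And>t. t \<in> {0..<T} \<Longrightarrow> 0 \<le> y t + g t"
    and y_eq: "\<And>t. t \<in> {0..<T} \<Longrightarrow> y t = x0 + integral {0..t} (R y)"
    using sol unfolding solution_on_def R_def by auto
  have R_cont: "continuous_on {0..<T} (R y)"
    unfolding R_def using y_cont y_nonneg by (intro rate_continuous) auto
  have K: "0 \<le> K" using bound[of 0] solution_ge[OF sol, of 0] assms(2,3) by simp
  have "continuous_on {0..T} (R (\<lambda>_. K))"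
    unfolding R_def using K g_nonneg by (intro rate_continuous) auto
  then have "bounded (R (\<lambda>_. K) ` {0..T})"
    by (intro compact_imp_bounded compact_continuous_image) auto
  then obtain M where "M > 0" and M: "\<And>s. s \<in> {0..T} \<Longrightarrow> R (\<lambda>_. K) s \<le> M"
    by (force simp: bounded_pos)
  have R_M: "norm (R y s) \<le> M" if "s \<in> {0..<T}" for s
  proof -
    have "0 \<le> R y s" unfolding R_def using that y_nonneg by (intro rate_nonneg) auto
    moreover have "R y s \<le> R (\<lambda>_. K) s"
      unfolding R_def using that y_nonneg[of s] bound[of s] a_pos[of s]
      by (intro mult_left_mono b_le) auto
    ultimately show ?thesis using M[of s] that by simp
  qed
  have lip: "norm (y t - y s) \<le> M * (t - s)" if "0 \<le> s" "s \<le> t" "t < T" for s t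
  proof -
    have "integral {0..t} (R y) = integral {0..s} (R y) + integral {s..t} (R y)"
      using that R_cont
      by (intro Henstock_Kurzweil_Integration.integral_combine[symmetric] integrable_continuous_real)
        (auto intro: continuous_on_subset)
    then have "y t - y s = integral {s..t} (R y)"
      using y_eq[of t] y_eq[of s] that by simp
    also have "norm \<dots> \<le> M * (t - s)"
      using that R_M R_cont by (intro integral_bound) (auto intro: continuous_on_subset)
    finally show ?thesis .
  qed
  have "M-lipschitz_on {0..<T} y"
  proof (rule lipschitz_onI)
    fix s t assume "s \<in> {0..<T}" "t \<in> {0..<T}"
    then show "dist (y s) (y t) \<le> M * dist s t"
      using lip[of s t] lip[of t s] by (cases "s \<le> t") (auto simp: dist_norm abs_minus_commute)
  qed (use \<open>M > 0\<close> in simp)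
  then have "uniformly_continuous_on {0..<T} y"
    by (rule lipschitz_on_uniformly_continuous)
  then obtain z where z: "uniformly_continuous_on (closure {0..<T}) z"
    and z_y: "\<And>t. t \<in> {0..<T} \<Longrightarrow> z t = y t"
    using uniformly_continuous_on_extension_on_closure by metis
  have cl: "closure {0..<T} = {0..T}" using assms by simp
  have z_cont: "continuous_on {0..T} z"
    using z uniformly_continuous_imp_continuous cl by force
  have z_ge: "x0 \<le> z t" if "t \<in> {0..T}" for t
    using that z_cont solution_ge[OF sol] z_y
    by (intro continuous_ge_on_closure[of "{0..<T}" z t x0]) (auto simp: cl)
  have z_nonneg: "0 \<le> z t + g t" if "t \<in> {0..T}" for t
    using that z_ge[of t] g_nonneg[of t] assms by simp
  have Rz_cont: "continuous_on {0..T} (R z)"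
    unfolding R_def using z_cont z_nonneg by (intro rate_continuous) auto
  \<comment> \<open>For the extended function, the equation says that \<open>D\<close> is the
    constant \<open>x0\<close>. This holds on \<open>{0..<T}\<close> and reaches \<open>T\<close> by
    continuity.\<close>
  define D where "D t = z t - integral {0..t} (R z)" for t
  have "D t = x0" if t: "t \<in> {0..T}" for t
  proof (rule continuous_constant_on_closure[of "{0..<T}" D])
    show "continuous_on (closure {0..<T}) D"
      unfolding D_def cl using z_cont Rz_cont
      by (intro continuous_intros indefinite_integral_continuous_1 integrable_continuous_real)
    fix s assume s: "s \<in> {0..<T}"
    have "integral {0..s} (R z) = integral {0..s} (R y)"
      using s by (intro integral_cong) (simp add: R_def z_y)
    then show "D s = x0" using y_eq[OF s] z_y[OF s] by (simp add: D_def)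
  qed (use t cl in simp)
  then have "z t = x0 + integral {0..t} (R z)" if "t \<in> {0..T}" for t
    using that by (simp add: D_def algebra_simps)
  then have "solution_on a b g x0 {0..T} z"
    unfolding solution_on_def using z_cont z_nonneg assms(3)
    by (auto simp: R_def is_interval_cc)
  then show thesis using that z_y by blast
qed

section \<open>Comparison by separation of variables, and blow-up\<close>

text \<open>Replacing \<open>g s\<close> by the constant \<open>G\<close> turns the equation into
  the separable inequality w' \<le> a b(w) for w = y + G. Dividing by b(w) and integrating over
  \<open>{0..t}\<close> gives the claim.\<close>

lemma integral_inverse_rate_le:
  assumes sol: "solution_on a b g x0 I y" and "0 < x0" and "t \<in> I"
    and G: "\<And>s. s \<in> {0..t} \<Longrightarrow> g s \<le> G"
  shows "integral {x0 + G..y t + G} (\<lambda>s. 1 / b s) \<le> integral {0..t} a"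
proof -
  define R where "R = (\<lambda>s. a s * b (y s + g s))"
  have I: "is_interval I" "I \<subseteq> {0..}" "0 \<in> I" and y_cont: "continuous_on I y"
    and y_nonneg: "\<And>t. t \<in> I \<Longrightarrow> 0 \<le> y t + g t"
    and eq: "\<And>t. t \<in> I \<Longrightarrow> y t = x0 + integral {0..t} R"
    using sol unfolding solution_on_def R_def by auto
  have t0: "0 \<le> t" using I \<open>t \<in> I\<close> by auto
  have sub: "{0..t} \<subseteq> I"
    using mem_is_interval_1_I[OF I(1,3) \<open>t \<in> I\<close>] by auto
  have G0: "0 \<le> G" using G[of 0] g_nonneg[of 0] t0 by simp
  have y_ge: "x0 \<le> y s" if "s \<in> {0..t}" for s
    using solution_ge[OF sol] that sub by auto
  have R_cont: "continuous_on {0..t} R"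
    unfolding R_def using rate_continuous[OF y_cont I(2)] y_nonneg sub by (auto intro: continuous_on_subset)
  have a_cont': "continuous_on {0..t} a" using a_cont by (auto intro: continuous_on_subset)
  \<comment> \<open>This is y + G on \<open>{0..t}\<close>, written as an integral so that the
    fundamental theorem of calculus gives its derivative.\<close>
  define w where "w s = x0 + integral {0..s} R + G" for s
  have w_y: "w s = y s + G" if "s \<in> {0..t}" for s
    using that eq[of s] sub by (auto simp: w_def)
  \<comment> \<open>Starting the primitive at 0 puts every positive \<open>x\<close> in the interior
    of \<open>{0..x + 1}\<close>, which yields a two-sided derivative. The choice of lower limit
    cancels in differences.\<close>
  define F where "F x = integral {0..x} (\<lambda>s. 1 / b s)" for x
  have F_deriv: "(F has_real_derivative 1 / b x) (at x)" if "0 < x" for x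
  proof -
    have "(F has_real_derivative 1 / b x) (at x within {0..x + 1})"
      unfolding F_def using that by (intro integral_has_real_derivative inverse_b_continuous) auto
    then show ?thesis using that by (simp add: at_within_Icc_at)
  qed
  define D where "D s = integral {0..s} a - F (w s)" for s
  have w_cont: "continuous_on {0..t} w"
    unfolding w_def using R_cont
    by (intro continuous_intros indefinite_integral_continuous_1 integrable_continuous_real)
  have w_pos: "0 < w s" if "s \<in> {0..t}" for s
    using y_ge[OF that] w_y[OF that] G0 \<open>0 < x0\<close> by simp
  have F_cont: "continuous_on {0<..} F"
    using F_deriv by (intro continuous_at_imp_continuous_on) (auto intro: DERIV_isCont)
  have "D 0 \<le> D t"
  proof (rule DERIV_nonneg_imp_increasing_open[OF t0])
    show "continuous_on {0..t} D"
      unfolding D_def using w_cont a_cont' w_pos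
      by (intro continuous_intros indefinite_integral_continuous_1 integrable_continuous_real
          continuous_on_compose2[OF F_cont]) auto
  next
    fix s assume s: "0 < s" "s < t"
    have "(w has_real_derivative R s) (at s within {0..t})"
      unfolding w_def using s R_cont
      by (auto intro!: derivative_eq_intros integral_has_real_derivative)
    then have dw: "(w has_real_derivative R s) (at s)" using s by (simp add: at_within_Icc_at)
    have "((\<lambda>s. integral {0..s} a) has_real_derivative a s) (at s within {0..t})"
      using s a_cont' by (intro integral_has_real_derivative) auto
    then have da: "((\<lambda>s. integral {0..s} a) has_real_derivative a s) (at s)"
      using s by (simp add: at_within_Icc_at)
    have "(D has_real_derivative a s - 1 / b (w s) * R s) (at s)"
      unfolding D_def using w_pos s by (intro DERIV_diff da DERIV_chain2[OF F_deriv dw]) auto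
    moreover have "1 / b (w s) * R s \<le> a s"
    proof -
      have "b (y s + g s) \<le> b (w s)"
        using G[of s] s y_nonneg[of s] subsetD[OF sub, of s] by (intro b_le) (auto simp: w_y)
      then have "R s \<le> a s * b (w s)"
        unfolding R_def using a_pos[of s] s by (intro mult_left_mono) auto
      moreover have "b (w s) > 0" using w_pos[of s] s by (intro b_pos) auto
      ultimately show ?thesis by (simp add: field_simps)
    qed
    ultimately show "\<exists>r. (D has_real_derivative r) (at s) \<and> 0 \<le> r" by force
  qed
  moreover have "w 0 = x0 + G" "w t = y t + G" using w_y[of t] t0 by (auto simp: w_def)
  ultimately have "F (y t + G) - F (x0 + G) \<le> integral {0..t} a"
    by (simp add: D_def)
  moreover have "F (y t + G) = F (x0 + G) + integral {x0 + G..y t + G} (\<lambda>s. 1 / b s)"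
    unfolding F_def using y_ge[of t] t0 G0 \<open>0 < x0\<close>
    by (intro Henstock_Kurzweil_Integration.integral_combine[symmetric] integrable_continuous_real
        inverse_b_continuous) auto
  ultimately show ?thesis by simp
qed

text \<open>Blow-up has to be derived from maximality: a closed lifetime could be extended beyond
  its end, and a bounded solution on a half-open one could be extended to the endpoint.\<close>

lemma maximal_solution_bounded_lifetime:
  assumes sol: "solution_on a b g x0 I y" and "0 < x0" and "bdd_above I"
    and maximal: "\<forall>J z. solution_on a b g x0 J z \<and> I \<subseteq> J \<and> (\<forall>t\<in>I. z t = y t) \<longrightarrow> J = I"
  obtains T where "0 < T" "I = {0..<T}" "\<And>K. \<exists>t\<in>I. K < y t"
proof -
  have I: "is_interval I" "I \<subseteq> {0..}" "0 \<in> I"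
    using sol unfolding solution_on_def by auto
  show thesis
  proof (rule interval_from_zero_cases[OF I \<open>bdd_above I\<close>])
    fix T assume T: "0 \<le> T" "I = {0..T}"
    obtain d z where z: "0 < d" "solution_on a b g x0 {0..T + d} z" "\<And>t. t \<in> {0..T} \<Longrightarrow> z t = y t"
      using solution_extends_beyond[of x0 T y] sol T \<open>0 < x0\<close> by metis
    then have "{0..T + d} = I"
      using T by (intro maximal[rule_format, of _ z]) auto
    moreover have "T + d \<in> {0..T + d}" "T + d \<notin> I"
      using T z(1) by auto
    ultimately show thesis by blast
  next
    fix T assume T: "0 < T" "I = {0..<T}"
    have "\<exists>t\<in>I. K < y t" for K
    proof (rule ccontr)
      assume "\<not> (\<exists>t\<in>I. K < y t)"
      then have "\<And>t. t \<in> {0..<T} \<Longrightarrow> y t \<le> K" using T by force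
      then obtain z where z: "solution_on a b g x0 {0..T} z" "\<And>t. t \<in> {0..<T} \<Longrightarrow> z t = y t"
        using bounded_solution_extends_to_endpoint[of x0 T y K] sol T \<open>0 < x0\<close> by metis
      then have "{0..T} = I"
        using T z by (intro maximal[rule_format, of _ z]) auto
      moreover have "T \<in> {0..T}" "T \<notin> I"
        using T by auto
      ultimately show False by blast
    qed
    then show thesis using that T by blast
  qed
qed

end

section \<open>Comparison of the two total integrals\<close>

theorem proposition7:
  fixes a b g :: "real \<Rightarrow> real" and x0 :: real and Y :: "real \<Rightarrow> ereal"
  assumes a_cont: "continuous_on {0..} a" and a_pos: "\<And>t. t \<ge> 0 \<Longrightarrow> a t > 0"
    and b_cont: "continuous_on {0..} b" and b_pos: "\<And>x. x \<ge> 0 \<Longrightarrow> b x > 0"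
    and g_cont: "continuous_on {0..} g" and g_nonneg: "\<And>t. t \<ge> 0 \<Longrightarrow> g t \<ge> 0"
    and x0_pos: "x0 > 0"
    and b_mono: "mono_on {0..} b"
    and g_bound: "\<And>t. t \<ge> 0 \<Longrightarrow>
      ennreal (running_sup g t) < ennreal (b x0) * tail_integral a t"
    and Y_sol: "maximal_solution a b g x0 Y"
    and Y_explodes: "explodes_in_finite_time Y"
  shows "B_inf b x0 < A_inf a"
proof -
  interpret increasing_rate a b g
    by unfold_locales (fact a_cont a_pos b_cont b_pos g_cont g_nonneg b_mono)+
  obtain I y where sol: "solution_on a b g x0 I y"
    and maximal: "\<forall>J z. solution_on a b g x0 J z \<and> I \<subseteq> J \<and> (\<forall>t\<in>I. z t = y t) \<longrightarrow> J = I"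
    and Y: "\<forall>t\<ge>0. Y t = (if t \<in> I then ereal (y t) else \<infinity>)"
    using Y_sol unfolding maximal_solution_def by (elim exE conjE)
  have I: "I \<subseteq> {0..}" "0 \<in> I"
    using sol unfolding solution_on_def by auto
  have le_explosion: "ereal t \<le> explosion_time Y" if "t \<in> I" for t
    unfolding explosion_time_def using that I Y by (intro Sup_upper) auto
  \<comment> \<open>The explosion time is an upper bound of \<open>I\<close>. It is a real number:
    explosion excludes infinity, and the point 0 of \<open>I\<close> excludes minus
    infinity.\<close>
  then have bdd: "bdd_above I"
    using Y_explodes I(2) unfolding explodes_in_finite_time_def bdd_above_def
    by (cases "explosion_time Y") auto
  obtain T where T: "0 < T" "I = {0..<T}" and unbounded: "\<And>K. \<exists>t\<in>I. K < y t"
    using maximal_solution_bounded_lifetime[OF sol x0_pos bdd maximal] by blast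
  define G where "G = running_sup g T"
  \<comment> \<open>A real supremum is an upper bound only for a set that is bounded above;
    compactness of \<open>{0..T}\<close> supplies this.\<close>
  have "bdd_above (g ` {0..T})"
    using g_cont by (intro compact_imp_bounded[THEN bounded_imp_bdd_above] compact_continuous_image)
      (auto intro: continuous_on_subset)
  then have G: "g s \<le> G" if "s \<in> {0..T}" for s
    unfolding G_def running_sup_def using that by (intro cSUP_upper) auto
  have G0: "0 \<le> G" using G[of 0] g_nonneg[of 0] T by simp
  have a_int: "a integrable_on {0..t}" for t
    using a_cont by (intro integrable_continuous_real) (auto intro: continuous_on_subset)
  have far: "tail_integral (\<lambda>s. 1 / b s) (x0 + G) \<le> ennreal (integral {0..T} a)"
  proof (rule tail_integral_le)
    show "continuous_on {x0 + G..} (\<lambda>s. 1 / b s)"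
      using x0_pos G0 by (intro inverse_b_continuous) auto
    show "0 \<le> 1 / b x" if "x0 + G \<le> x" for x
      using b_pos[of x] that x0_pos G0 by simp
    fix x assume x: "x0 + G \<le> x"
    \<comment> \<open>Unboundedness gives a time at which \<open>y\<close> has passed level
      \<open>x\<close>, so \<open>{x0 + G..x}\<close> lies in the range covered by the comparison at
      time \<open>t\<close>.\<close>
    obtain t where t: "t \<in> I" "x < y t" using unbounded by blast
    have "integral {x0 + G..x} (\<lambda>s. 1 / b s) \<le> integral {x0 + G..y t + G} (\<lambda>s. 1 / b s)"
      using t x x0_pos G0 b_pos
      by (intro integral_subset_le integrable_continuous_real inverse_b_continuous) (auto intro: less_imp_le)
    also have "\<dots> \<le> integral {0..t} a"
      using G t T by (intro integral_inverse_rate_le[OF sol x0_pos]) auto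
    also have "\<dots> \<le> integral {0..T} a"
      using t T a_pos by (intro integral_subset_le a_int) (auto intro: less_imp_le)
    finally show "integral {x0 + G..x} (\<lambda>s. 1 / b s) \<le> integral {0..T} a" .
  qed
  have "integral {x0..x0 + G} (\<lambda>s. 1 / b s) \<le> integral {x0..x0 + G} (\<lambda>s. 1 / b x0)"
    using x0_pos b_pos b_le
    by (intro integral_le integrable_continuous_real inverse_b_continuous) (auto intro!: divide_left_mono)
  then have near: "integral {x0..x0 + G} (\<lambda>s. 1 / b s) \<le> G / b x0"
    using G0 by simp
  \<comment> \<open>This is the hypothesis on \<open>g\<close> at time \<open>T\<close>, divided by
    \<open>b x0\<close>. If the tail is infinite, finiteness of the left side suffices.\<close>
  have "ennreal (G / b x0) < tail_integral a T"
  proof (cases "tail_integral a T")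
    case (real r)
    then show ?thesis
      using g_bound[of T] T b_pos[of x0] x0_pos G0
      by (simp add: G_def[symmetric] ennreal_mult[symmetric] ennreal_less_iff field_simps)
  qed simp
  moreover have "B_inf b x0 \<le> ennreal (G / b x0) + ennreal (integral {0..T} a)"
  proof -
    have "B_inf b x0 = ennreal (integral {x0..x0 + G} (\<lambda>s. 1 / b s)) + tail_integral (\<lambda>s. 1 / b s) (x0 + G)"
      unfolding B_inf_def using x0_pos G0 b_pos
      by (intro tail_integral_split inverse_b_continuous) (auto intro: less_imp_le)
    then show ?thesis using near far by (simp add: add_mono ennreal_leI)
  qed
  moreover have "A_inf a = ennreal (integral {0..T} a) + tail_integral a T"
    unfolding A_inf_def using T a_pos a_cont by (intro tail_integral_split) (auto intro: less_imp_le)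
  \<comment> \<open>Adding the integral of \<open>a\<close> over \<open>{0..T}\<close> preserves
    strictness because that term is finite, even when \<open>A_inf a\<close> is infinite.\<close>
  ultimately show ?thesis
    by (metis add.commute ennreal_add_left_cancel_less ennreal_neq_top le_less_trans infinity_ennreal_def)
qed

end
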